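(* The affine hull of $P_{\mathrm{utt}}(n)$ is the set of all $(x,y)\in\mathbb R^{\mathcal M}\times\mathbb R^{V\times A}$ satisfying the equations $$\sum_{j\in V\setminus\{i\}}(x_{k,i,j}+x_{k,j,i})=1\quad\forall k\in S,\ k\ge 2,\ \forall i\in V,\qquad \sum_{k\in S}x_{k,i,j}=1\quad\forall (i,j)\in A,$$ and these equations are irredundant (none is a linear combination of the others).
   Context: Let $n\ge4$ be even, $V=\{1,\dots,n\}$ (teams; team $i$ has home venue $i$), $S=\{1,\dots,2n-2\}$ (slots), $A=\{(i,j)\in V\times V:i\ne j\}$, $\mathcal M=\{(k,i,j):k\in S,(i,j)\in A\}$, where $(k,i,j)$ denotes the match between $i$ and $j$ at venue $i$ in slot $k$ ($i$ plays home, $j$ away). A tournament is a set $T\subseteq\mathcal M$ whose incidence vector $\chi(T)\in\{0,1\}^{\mathcal M}$ satisfies the two families of equations above. In a tournament $T$, team $t$ is at venue $t$ in a slot where it plays at home and at venue $i$ in slot $k$ if $(k,i,t)\in T$; before slot $1$ and after slot $2n-2$ it is at its home venue $t$. Team $t$ travels from venue $i$ to venue $j\neq i$ if it is at $i$ and then at $j$ at two consecutive positions of the sequence (start, slot $1$, …, slot $2n-2$, end). The travel vector $\psi(T)\in\{0,1\}^{V\times A}$ has $\psi(T)_{t,i,j}=1$ iff team $t$ travels from venue $i$ to venue $j$. The unconstrained traveling tournament polytope is $P_{\mathrm{utt}}(n)=\mathrm{conv}\{(\chi(T),y)\in\{0,1\}^{\mathcal M}\times\{0,1\}^{V\times A}: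 T\text{ tournament},\ y\ge\psi(T)\}$. *)

theory Defs
  imports "HOL-Analysis.Analysis" "HOL-Library.Function_Algebras"
begin

text \<open>
  The ambient spaces are coordinate spaces over finite index sets that depend on a number \<open>n\<close>.
  A vector is a function that vanishes outside its index set; the pointwise vector space
  structure on functions makes the library's convex and affine hulls available.
\<close>

instantiation "fun" :: (type, real_vector) real_vector
begin

definition scaleR_fun :: "real \<Rightarrow> ('a \<Rightarrow> 'b) \<Rightarrow> 'a \<Rightarrow> 'b"
  where "scaleR_fun c f = (\<lambda>x. c *\<^sub>R f x)"

instance
  by standard (simp_all add: scaleR_fun_def fun_eq_iff scaleR_add_right scaleR_add_left)

end

definition coord_space :: "'a set \<Rightarrow> ('a \<Rightarrow> real) set"
  where "coord_space I = {x. \<forall>a. a \<notin> I \<longrightarrow> x a = 0}"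

definition teams :: "nat \<Rightarrow> nat set"
  where "teams n = {1..n}"

definition slots :: "nat \<Rightarrow> nat set"
  where "slots n = {1..2 * n - 2}"

definition arcs :: "nat \<Rightarrow> (nat \<times> nat) set"
  where "arcs n = {(i, j). i \<in> teams n \<and> j \<in> teams n \<and> i \<noteq> j}"

text \<open>\<open>(k, i, j)\<close> is the match in slot \<open>k\<close> of home team \<open>i\<close> against away team \<open>j\<close>.\<close>

definition matches :: "nat \<Rightarrow> (nat \<times> nat \<times> nat) set"
  where "matches n = slots n \<times> arcs n"

definition tournament :: "nat \<Rightarrow> (nat \<times> nat \<times> nat) set \<Rightarrow> bool"
  where "tournament n T \<longleftrightarrow>
    T \<subseteq> matches n \<and>
    (\<forall>k\<in>slots n. \<forall>i\<in>teams n.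
      (\<Sum>j\<in>teams n - {i}. indicat_real T (k, i, j) + indicat_real T (k, j, i)) = 1) \<and>
    (\<forall>(i, j)\<in>arcs n. (\<Sum>k\<in>slots n. indicat_real T (k, i, j)) = 1)"

text \<open>The slot equations for slot \<open>1\<close> are implied by the remaining equations.\<close>

lemma tournament_iff:
  assumes "n \<ge> 2"
  shows "tournament n T \<longleftrightarrow>
    T \<subseteq> matches n \<and>
    (\<forall>k\<in>slots n. k \<ge> 2 \<longrightarrow> (\<forall>i\<in>teams n.
      (\<Sum>j\<in>teams n - {i}. indicat_real T (k, i, j) + indicat_real T (k, j, i)) = 1)) \<and>
    (\<forall>(i, j)\<in>arcs n. (\<Sum>k\<in>slots n. indicat_real T (k, i, j)) = 1)"
    (is "_ \<longleftrightarrow> _ \<and> ?S \<and> ?M")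
proof -
  let ?f = "\<lambda>k i. \<Sum>j\<in>teams n - {i}. indicat_real T (k, i, j) + indicat_real T (k, j, i)"
  have "?f 1 i = 1" if S: ?S and M: ?M and i: "i \<in> teams n" for i
  proof -
    have split: "slots n = insert 1 {2..2 * n - 2}"
      using assms by (auto simp: slots_def)
    have "(\<Sum>k\<in>slots n. ?f k i)
        = (\<Sum>j\<in>teams n - {i}. \<Sum>k\<in>slots n. indicat_real T (k, i, j) + indicat_real T (k, j, i))"
      by (rule sum.swap)
    also have "\<dots> = (\<Sum>j\<in>teams n - {i}. 2)"
      using M i by (intro sum.cong) (auto simp: sum.distrib arcs_def)
    also have "\<dots> = 2 * (real n - 1)"
      using i assms by (simp add: teams_def of_nat_diff)
    finally have total: "(\<Sum>k\<in>slots n. ?f k i) = 2 * (real n - 1)" .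
    have "(\<Sum>k\<in>{2..2 * n - 2}. ?f k i) = (\<Sum>k\<in>{2..2 * n - 2}. 1)"
      using S i by (intro sum.cong) (auto simp: slots_def)
    also have "\<dots> = 2 * real n - 3"
      using assms by (simp add: of_nat_diff)
    finally show ?thesis
      using total unfolding split by simp
  qed
  moreover have "k = 1 \<or> k \<ge> 2" if "k \<in> slots n" for k
    using that by (auto simp: slots_def)
  ultimately show ?thesis
    unfolding tournament_def by blast
qed

text \<open>
  Positions \<open>0\<close> and \<open>2 * n - 1\<close> are the start and the end of the sequence, and position
  \<open>p\<close> with \<open>1 \<le> p \<le> 2 * n - 2\<close> is slot \<open>p\<close>.
\<close>

definition at_venue :: "nat \<Rightarrow> (nat \<times> nat \<times> nat) set \<Rightarrow> nat \<Rightarrow> nat \<Rightarrow> nat \<Rightarrow> bool"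
  where "at_venue n T t p i \<longleftrightarrow>
    (i = t \<and> (p = 0 \<or> p = 2 * n - 1 \<or> (\<exists>j. (p, t, j) \<in> T))) \<or> (p, i, t) \<in> T"

definition travels :: "nat \<Rightarrow> (nat \<times> nat \<times> nat) set \<Rightarrow> nat \<Rightarrow> nat \<Rightarrow> nat \<Rightarrow> bool"
  where "travels n T t i j \<longleftrightarrow>
    i \<noteq> j \<and> (\<exists>p<2 * n - 1. at_venue n T t p i \<and> at_venue n T t (Suc p) j)"

definition travel_vector :: "nat \<Rightarrow> (nat \<times> nat \<times> nat) set \<Rightarrow> nat \<times> nat \<times> nat \<Rightarrow> real"
  where "travel_vector n T =
    indicat_real {(t, i, j). (t, i, j) \<in> teams n \<times> arcs n \<and> travels n T t i j}"

definition P_utt :: "nat \<Rightarrow> ((nat \<times> nat \<times> nat \<Rightarrow> real) \<times> (nat \<times> nat \<times> nat \<Rightarrow> real)) set"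
  where "P_utt n = convex hull
    {(indicat_real T, y) | T y.
      tournament n T \<and>
      y \<in> coord_space (teams n \<times> arcs n) \<and>
      (\<forall>a\<in>teams n \<times> arcs n. y a \<in> {0, 1} \<and> travel_vector n T a \<le> y a)}"

definition utt_space :: "nat \<Rightarrow> ((nat \<times> nat \<times> nat \<Rightarrow> real) \<times> (nat \<times> nat \<times> nat \<Rightarrow> real)) set"
  where "utt_space n = coord_space (matches n) \<times> coord_space (teams n \<times> arcs n)"

text \<open>
  A system of equations \<open>L e v = b e\<close> for \<open>e \<in> E\<close>, with \<open>L e\<close> a linear functional on \<open>X\<close>.
  Linear combinations are taken of whole equations, i.e. of both sides simultaneously.
\<close>

definition irredundant :: "'e set \<Rightarrow> 'v set \<Rightarrow> ('e \<Rightarrow> 'v \<Rightarrow> real) \<Rightarrow> ('e \<Rightarrow> real) \<Rightarrow> bool"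
  where "irredundant E X L b \<longleftrightarrow>
    (\<forall>e\<in>E. \<not> (\<exists>c. (\<forall>v\<in>X. L e v = (\<Sum>e'\<in>E - {e}. c e' * L e' v)) \<and>
                  b e = (\<Sum>e'\<in>E - {e}. c e' * b e')))"

datatype equation_index = Slot_Eq nat nat | Match_Eq nat nat

definition equations :: "nat \<Rightarrow> equation_index set"
  where "equations n =
    {Slot_Eq k i | k i. k \<in> slots n \<and> k \<ge> 2 \<and> i \<in> teams n} \<union>
    {Match_Eq i j | i j. (i, j) \<in> arcs n}"

fun lhs :: "nat \<Rightarrow> equation_index \<Rightarrow>
    (nat \<times> nat \<times> nat \<Rightarrow> real) \<times> (nat \<times> nat \<times> nat \<Rightarrow> real) \<Rightarrow> real"
  where
    "lhs n (Slot_Eq k i) (x, y) = (\<Sum>j\<in>teams n - {i}. x (k, i, j) + x (k, j, i))"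
  | "lhs n (Match_Eq i j) (x, y) = (\<Sum>k\<in>slots n. x (k, i, j))"

end

theory Submission
  imports Defs
begin

text \<open>
  A point outside the affine hull is separated from it by a linear functional that is constant on
  the generators. Its coefficients on the travel variables vanish, since every travel is avoided by
  some tournament. For its coefficients \<open>c\<close> on the match variables, swapping the venues of a pair of
  teams shows that \<open>g = c k1 - c k2\<close> is symmetric for any two slots, and swapping the two slots shows
  that \<open>g\<close> has the same sum over the matches of either slot. Antisymmetrising over two disjoint
  transpositions of teams yields \<open>g (a, p) + g (b, q) = g (b, p) + g (a, q)\<close>, hence
  \<open>g (i, j) = u i + u j\<close>. So the functional is a combination of the equations and cannot separate
  one of their solutions. For the irredundancy, each equation has a vector on which its
  left-hand side is nonzero and all other left-hand sides vanish.
\<close>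

section \<open>Linear algebra in coordinate spaces\<close>

lemma sum_eq_single:
  assumes "finite A" "a \<in> A" "\<And>b. b \<in> A \<Longrightarrow> b \<noteq> a \<Longrightarrow> f b = 0"
  shows "sum f A = f a"
  using assms by (simp add: sum.remove)

text \<open>\<open>affine hull S\<close> is \<open>p\<close> plus the span of the differences
  \<open>s - p\<close>. If \<open>v\<close> lies outside, a functional can be 1 on
  \<open>v - p\<close> and 0 on all these differences.\<close>

lemma affine_hull_separation:
  fixes S :: "'a::real_vector set"
  assumes p: "p \<in> S" and v: "v \<notin> affine hull S"
  obtains f :: "'a \<Rightarrow> real" where "linear f" "\<And>s. s \<in> S \<Longrightarrow> f s = f p" "f v \<noteq> f p"
proof -
  define W where "W = (\<lambda>x. - p + x) ` (S - {p})"
  have "v - p \<notin> span W"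
  proof
    assume "v - p \<in> span W"
    then have "p + (v - p) \<in> affine hull S"
      unfolding affine_hull_span2[OF p] W_def by blast
    then show False using v by simp
  qed
  \<comment> \<open>Values of a linear map can be prescribed freely only on an independent set,
    hence the passage from \<open>W\<close> to a basis of its span.\<close>
  obtain B where B: "B \<subseteq> W" "independent B" "W \<subseteq> span B"
    using maximal_independent_subset[of W] by metis
  have "v - p \<notin> span B"
    using \<open>v - p \<notin> span W\<close> span_mono[OF B(1)] by blast
  then have "independent (insert (v - p) B)"
    using B(2) by (rule independent_insertI)
  then obtain f :: "'a \<Rightarrow> real" where f: "linear f"
    and fB: "\<And>x. x \<in> insert (v - p) B \<Longrightarrow> f x = (if x = v - p then 1 else 0)"
    using linear_independent_extend[of "insert (v - p) B" "\<lambda>x. if x = v - p then 1 else 0"]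
    by blast
  have "v - p \<notin> B"
    using \<open>v - p \<notin> span B\<close> span_base by blast
  have f0: "f w = 0" if "w \<in> span B" for w
    by (rule linear_eq_0_on_span[OF f _ that]) (use fB \<open>v - p \<notin> B\<close> in auto)
  show thesis
  proof
    show "linear f" by fact
    show "f s = f p" if "s \<in> S" for s
    proof (cases "s = p")
      case False
      then have "- p + s \<in> W" using that by (auto simp: W_def)
      then have "f (- p + s) = 0" using f0 B(3) by blast
      then show ?thesis
        using linear_add[OF f, of "- p" s] linear_neg[OF f, of p] by simp
    qed simp
    show "f v \<noteq> f p"
      using fB[of "v - p"] linear_diff[OF f, of v p] by auto
  qed
qed

lemma sum_fun_app: "(\<Sum>a\<in>A. f a) x = (\<Sum>a\<in>A. f a x)"
  by (induction A rule: infinite_finite_induct) auto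

text \<open>A vector supported on the finite set \<open>I\<close> is a finite combination of unit
  vectors, so a functional on the whole function space acts on it through finitely many
  coefficients.\<close>

lemma linear_on_coord_space:
  fixes f :: "('a \<Rightarrow> real) \<Rightarrow> real"
  assumes f: "linear f" and I: "finite I" and x: "x \<in> coord_space I"
  shows "f x = (\<Sum>a\<in>I. f (indicat_real {a}) * x a)"
proof -
  have "x = (\<Sum>a\<in>I. x a *\<^sub>R indicat_real {a})"
  proof
    fix b
    have "(\<Sum>a\<in>I. x a * indicat_real {a} b) = x b"
    proof (cases "b \<in> I")
      case True
      then show ?thesis
        using I by (subst sum_eq_single[of I b]) auto
    next
      case False
      then have "(\<Sum>a\<in>I. x a * indicat_real {a} b) = 0"
        by (intro sum.neutral) (auto simp: indicator_def)
      then show ?thesis using False x by (auto simp: coord_space_def)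
    qed
    then show "x b = (\<Sum>a\<in>I. x a *\<^sub>R indicat_real {a}) b"
      by (simp add: sum_fun_app scaleR_fun_def)
  qed
  then have "f x = f (\<Sum>a\<in>I. x a *\<^sub>R indicat_real {a})" by simp
  also have "\<dots> = (\<Sum>a\<in>I. f (indicat_real {a}) * x a)"
    by (simp add: linear_sum[OF f] linear_cmul[OF f] mult.commute)
  finally show ?thesis .
qed

lemma finite_teams [simp]: "finite (teams n)"
  by (simp add: teams_def)

lemma finite_slots [simp]: "finite (slots n)"
  by (simp add: slots_def)

lemma arcs_Sigma: "arcs n = Sigma (teams n) (\<lambda>i. teams n - {i})"
  by (auto simp: arcs_def)

lemma finite_arcs [simp]: "finite (arcs n)"
  by (simp add: arcs_Sigma)

lemma finite_matches [simp]: "finite (matches n)"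
  by (simp add: matches_def)

section \<open>Tournaments\<close>

lemma tournament_finite: "tournament n T \<Longrightarrow> finite T"
  using finite_subset[OF _ finite_matches] by (auto simp: tournament_def)

lemma tournament_arc:
  assumes "tournament n T" "(k, i, j) \<in> T"
  shows "k \<in> slots n" "i \<in> teams n" "j \<in> teams n" "i \<noteq> j"
  using assms by (auto simp: tournament_def matches_def arcs_def)

lemma tournament_slot_exists:
  assumes "tournament n T" "(i, j) \<in> arcs n"
  obtains k where "k \<in> slots n" "(k, i, j) \<in> T"
proof -
  have "(\<Sum>k\<in>slots n. indicat_real T (k, i, j)) \<noteq> 0"
    using assms by (auto simp: tournament_def)
  then obtain k where "k \<in> slots n" "indicat_real T (k, i, j) \<noteq> 0"
    by (meson sum.not_neutral_contains_not_neutral)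
  then show thesis using that by (auto simp: indicator_def split: if_splits)
qed

lemma tournament_slot_unique:
  assumes T: "tournament n T" and m: "(k, i, j) \<in> T" "(k', i, j) \<in> T"
  shows "k = k'"
proof (rule ccontr)
  assume "k \<noteq> k'"
  have "(i, j) \<in> arcs n" using tournament_arc[OF T m(1)] by (simp add: arcs_def)
  then have "(\<Sum>k\<in>slots n. indicat_real T (k, i, j)) = 1"
    using T by (auto simp: tournament_def)
  moreover have "(\<Sum>k\<in>{k, k'}. indicat_real T (k, i, j)) \<le> (\<Sum>k\<in>slots n. indicat_real T (k, i, j))"
    using tournament_arc(1)[OF T] m by (intro sum_mono2) auto
  ultimately show False using m \<open>k \<noteq> k'\<close> by simp
qed

lemma tournament_opponent_unique:
  assumes T: "tournament n T" and m: "(k, i, j) \<in> T \<or> (k, j, i) \<in> T" "(k, i, j') \<in> T \<or> (k, j', i) \<in> T"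
  shows "j = j'"
proof (rule ccontr)
  assume "j \<noteq> j'"
  let ?f = "\<lambda>j. indicat_real T (k, i, j) + indicat_real T (k, j, i)"
  have *: "k \<in> slots n" "i \<in> teams n" "j \<in> teams n - {i}" "j' \<in> teams n - {i}"
    using tournament_arc[OF T] m by blast+
  then have "sum ?f (teams n - {i}) = 1"
    using T by (auto simp: tournament_def)
  moreover have "sum ?f {j, j'} \<le> sum ?f (teams n - {i})"
    using * by (intro sum_mono2) auto
  moreover have "?f j \<ge> 1" "?f j' \<ge> 1"
    using m by (auto simp: indicator_def)
  ultimately show False using \<open>j \<noteq> j'\<close> by simp
qed

lemma tournament_home_away:
  assumes T: "tournament n T" and m: "(k, i, j) \<in> T"
  shows "(k, j, i) \<notin> T"
proof
  assume m': "(k, j, i) \<in> T"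
  let ?f = "\<lambda>j. indicat_real T (k, i, j) + indicat_real T (k, j, i)"
  note * = tournament_arc[OF T m]
  then have "sum ?f (teams n - {i}) = 1"
    using T by (auto simp: tournament_def)
  moreover have "sum ?f {j} \<le> sum ?f (teams n - {i})"
    using * by (intro sum_mono2) auto
  ultimately show False using m m' by simp
qed

text \<open>Each of the four ways to share a team reduces to uniqueness of the opponent, together
  with the fact that a match and its reversal never occupy the same slot.\<close>

lemma tournament_match_unique:
  assumes T: "tournament n T" and m: "(k, a, b) \<in> T" "(k, c, d) \<in> T"
    and "{a, b} \<inter> {c, d} \<noteq> {}"
  shows "(c, d) = (a, b)"
proof -
  consider "c = a" | "c = b" | "d = a" | "d = b" using assms(4) by blast
  then show ?thesis
  proof cases
    case 1 then show ?thesis using tournament_opponent_unique[OF T, of k a b d] m by auto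
  next
    case 2 then show ?thesis
      using tournament_opponent_unique[OF T, of k b a d] tournament_home_away[OF T] m by auto
  next
    case 3 then show ?thesis
      using tournament_opponent_unique[OF T, of k a b c] tournament_home_away[OF T] m by auto
  next
    case 4 then show ?thesis using tournament_opponent_unique[OF T, of k b a c] m by auto
  qed
qed

section \<open>Operations that preserve tournaments\<close>

definition relabel :: "(nat \<Rightarrow> nat) \<Rightarrow> (nat \<Rightarrow> nat) \<Rightarrow> (nat \<times> nat \<times> nat) set \<Rightarrow> (nat \<times> nat \<times> nat) set"
  where "relabel \<pi> \<sigma> T = {(k, i, j). (\<pi> k, \<sigma> i, \<sigma> j) \<in> T}"

text \<open>\<open>relabel\<close> pulls membership back along the permutations, so the new
  incidence vector is the old one composed with them. Each equation becomes an equation for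
  \<open>T\<close> after reindexing its sum.\<close>

lemma tournament_relabel:
  assumes T: "tournament n T" and \<pi>: "\<pi> permutes slots n" and \<sigma>: "\<sigma> permutes teams n"
  shows "tournament n (relabel \<pi> \<sigma> T)"
  unfolding tournament_def
proof (intro conjI ballI)
  let ?T = "relabel \<pi> \<sigma> T"
  have ind: "indicat_real ?T (k, i, j) = indicat_real T (\<pi> k, \<sigma> i, \<sigma> j)" for k i j
    by (simp add: relabel_def indicator_def)
  show "?T \<subseteq> matches n"
    using T permutes_in_image[OF \<pi>] permutes_in_image[OF \<sigma>]
    by (auto simp: relabel_def tournament_def matches_def arcs_def)
  show "(\<Sum>j\<in>teams n - {i}. indicat_real ?T (k, i, j) + indicat_real ?T (k, j, i)) = 1"
    if "k \<in> slots n" "i \<in> teams n" for k i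
  proof -
    have "bij_betw \<sigma> (teams n - {i}) (teams n - {\<sigma> i})"
      using bij_betw_DiffI[OF permutes_imp_bij[OF \<sigma>], of "{i}" "{\<sigma> i}"] that(2)
        permutes_in_image[OF \<sigma>] by simp
    from sum.reindex_bij_betw[OF this, of "\<lambda>j. indicat_real T (\<pi> k, \<sigma> i, j) + indicat_real T (\<pi> k, j, \<sigma> i)"]
    show ?thesis
      using T that permutes_in_image[OF \<pi>] permutes_in_image[OF \<sigma>]
      by (simp add: ind tournament_def)
  qed
  show "case e of (i, j) \<Rightarrow> (\<Sum>k\<in>slots n. indicat_real ?T (k, i, j)) = 1" if "e \<in> arcs n" for e
  proof -
    obtain i j where e: "e = (i, j)" by fastforce
    have "(\<sigma> i, \<sigma> j) \<in> arcs n"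
      using that permutes_in_image[OF \<sigma>] inj_eq[OF permutes_inj[OF \<sigma>]] by (simp add: arcs_def e)
    then show ?thesis
      using T sum.reindex_bij_betw[OF permutes_imp_bij[OF \<pi>], of "\<lambda>k. indicat_real T (k, \<sigma> i, \<sigma> j)"]
      by (auto simp: e ind tournament_def)
  qed
qed

definition swap_venues :: "nat \<Rightarrow> nat \<Rightarrow> (nat \<times> nat \<times> nat) set \<Rightarrow> (nat \<times> nat \<times> nat) set"
  where "swap_venues a b T = {(k, i, j). if {i, j} = {a, b} then (k, j, i) \<in> T else (k, i, j) \<in> T}"

text \<open>A slot equation adds both orientations of every pair and does not notice the swap. The
  match equations of \<open>(a, b)\<close> and \<open>(b, a)\<close> trade places.\<close>

lemma tournament_swap_venues:
  assumes T: "tournament n T"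
  shows "tournament n (swap_venues a b T)"
  unfolding tournament_def
proof (intro conjI ballI)
  let ?T = "swap_venues a b T"
  have ind: "indicat_real ?T (k, i, j) =
      (if {i, j} = {a, b} then indicat_real T (k, j, i) else indicat_real T (k, i, j))" for k i j
    by (simp add: swap_venues_def indicator_def)
  show "?T \<subseteq> matches n"
    using T by (auto simp: swap_venues_def tournament_def matches_def arcs_def split: if_splits)
  show "(\<Sum>j\<in>teams n - {i}. indicat_real ?T (k, i, j) + indicat_real ?T (k, j, i)) = 1"
    if "k \<in> slots n" "i \<in> teams n" for k i
  proof -
    have "(\<Sum>j\<in>teams n - {i}. indicat_real ?T (k, i, j) + indicat_real ?T (k, j, i)) =
        (\<Sum>j\<in>teams n - {i}. indicat_real T (k, i, j) + indicat_real T (k, j, i))"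
      by (intro sum.cong) (auto simp: ind insert_commute)
    then show ?thesis using T that by (simp add: tournament_def)
  qed
  show "case e of (i, j) \<Rightarrow> (\<Sum>k\<in>slots n. indicat_real ?T (k, i, j)) = 1" if "e \<in> arcs n" for e
  proof -
    obtain i j where e: "e = (i, j)" by fastforce
    then have "(i, j) \<in> arcs n" "(j, i) \<in> arcs n" using that by (auto simp: arcs_def)
    then show ?thesis using T by (cases "{i, j} = {a, b}") (auto simp: e ind tournament_def)
  qed
qed

text \<open>The circle method: team \<open>n\<close> plays the role of the point at infinity, and the other teams
  are the residues modulo \<open>n - 1\<close>.\<close>

definition circle_colour :: "nat \<Rightarrow> nat \<Rightarrow> nat \<Rightarrow> nat"
  where "circle_colour n i j =
    (if i = n then 2 * j else if j = n then 2 * i else i + j) mod (n - 1)"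

lemma mod_shift_inj:
  fixes i j m a :: nat
  assumes "i \<in> {1..m}" "j \<in> {1..m}" "(a + i) mod m = (a + j) mod m"
  shows "i = j"
proof -
  have "(int a + int i) mod int m = (int a + int j) mod int m"
    using assms(3) by (metis of_nat_add zmod_int)
  then have "int m dvd int i - int j"
    by (simp add: mod_eq_dvd_iff)
  moreover have "\<bar>int i - int j\<bar> < int m" using assms by auto
  ultimately show ?thesis
    using dvd_imp_le_int[of "int i - int j" "int m"] by linarith
qed

text \<open>Doubling is invertible modulo an odd number. With \<open>m = n - 1\<close>, this is
  where the circle method needs \<open>n\<close> to be even.\<close>

lemma mod_double_inj:
  fixes i j m :: nat
  assumes "i \<in> {1..m}" "j \<in> {1..m}" "odd m" "(2 * i) mod m = (2 * j) mod m"
  shows "i = j"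
proof -
  have "(2 * int i) mod int m = (2 * int j) mod int m"
    using assms(4) by (metis of_nat_mult of_nat_numeral zmod_int)
  then have "int m dvd 2 * (int i - int j)"
    by (simp add: mod_eq_dvd_iff right_diff_distrib)
  moreover have "coprime (int m) 2" using assms(3) by simp
  ultimately have "int m dvd int i - int j"
    using coprime_dvd_mult_right_iff by blast
  moreover have "\<bar>int i - int j\<bar> < int m" using assms by auto
  ultimately show ?thesis
    using dvd_imp_le_int[of "int i - int j" "int m"] by linarith
qed

lemma circle_colour_inj:
  assumes n: "n \<ge> 2" "even n" and i: "i \<in> teams n"
  shows "inj_on (circle_colour n i) (teams n - {i})"
proof (rule inj_onI)
  fix j j'
  assume j: "j \<in> teams n - {i}" "j' \<in> teams n - {i}" and eq: "circle_colour n i j = circle_colour n i j'"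
  have odd: "odd (n - 1)" using n by simp
  have *: "l \<in> {1..n - 1}" if "l \<in> teams n" "l \<noteq> n" for l using that by (auto simp: teams_def)
  show "j = j'"
  proof (cases "i = n")
    case True
    then show ?thesis
      using mod_double_inj[of j "n - 1" j'] * j eq odd by (auto simp: circle_colour_def)
  next
    case False
    \<comment> \<open>The colour of the pair \<open>i\<close>, \<open>n\<close> is that of
      \<open>i + i\<close>, so \<open>n\<close> takes the place of \<open>i\<close> itself, the
      residue missing among the opponents of \<open>i\<close>.\<close>
    then have c: "circle_colour n i l = (i + (if l = n then i else l)) mod (n - 1)" for l
      by (auto simp: circle_colour_def mult_2)
    have "(if j = n then i else j) = (if j' = n then i else j')"
      by (rule mod_shift_inj[of _ "n - 1" _ i]) (use False i j * eq c in auto)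
    then show ?thesis using j by (auto split: if_splits)
  qed
qed

text \<open>The \<open>n - 1\<close> opponents of \<open>i\<close> receive distinct colours out of
  \<open>n - 1\<close>, so every colour occurs. Each colour class is therefore a perfect
  matching.\<close>

lemma circle_colour_ex1:
  assumes n: "n \<ge> 2" "even n" and i: "i \<in> teams n" and r: "r < n - 1"
  shows "\<exists>!j. j \<in> teams n - {i} \<and> circle_colour n i j = r"
proof -
  have "circle_colour n i ` (teams n - {i}) = {..<n - 1}"
  proof (rule card_subset_eq)
    show "circle_colour n i ` (teams n - {i}) \<subseteq> {..<n - 1}"
      using n by (auto simp: circle_colour_def)
    show "card (circle_colour n i ` (teams n - {i})) = card {..<n - 1}"
      using i by (simp add: card_image[OF circle_colour_inj[OF n i]]) (simp add: teams_def)
  qed simp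
  then have "r \<in> circle_colour n i ` (teams n - {i})" using r by simp
  then show ?thesis
    using circle_colour_inj[OF n i] by (auto simp: inj_on_def)
qed

text \<open>The matching of colour \<open>r\<close> is played in slot \<open>r + 1\<close> with the
  smaller label at home and again in slot \<open>r + n\<close> with venues reversed.\<close>

lemma tournament_exists:
  assumes n: "n \<ge> 2" "even n"
  obtains T where "tournament n T"
proof
  define T where "T = {(k, i, j). (k, i, j) \<in> matches n \<and>
    circle_colour n i j = (k - 1) mod (n - 1) \<and> (i < j \<longleftrightarrow> k \<le> n - 1)}"
  have sym: "circle_colour n i j = circle_colour n j i" for i j
    by (auto simp: circle_colour_def add.commute)
  have less: "circle_colour n i j < n - 1" for i j using n by (simp add: circle_colour_def)
  show "tournament n T"
    unfolding tournament_def
  proof (intro conjI ballI)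
    show "T \<subseteq> matches n" by (auto simp: T_def)
    show "(\<Sum>j\<in>teams n - {i}. indicat_real T (k, i, j) + indicat_real T (k, j, i)) = 1"
      if ki: "k \<in> slots n" "i \<in> teams n" for k i
    proof -
      define r where "r = (k - 1) mod (n - 1)"
      have "r < n - 1" using n by (simp add: r_def)
      then obtain j0 where j0: "j0 \<in> teams n - {i}" "circle_colour n i j0 = r"
        and uniq: "\<And>j. j \<in> teams n - {i} \<Longrightarrow> circle_colour n i j = r \<Longrightarrow> j = j0"
        using circle_colour_ex1[OF n ki(2)] by metis
      let ?f = "\<lambda>j. indicat_real T (k, i, j) + indicat_real T (k, j, i)"
      have "?f j = 0" if "j \<in> teams n - {i}" "j \<noteq> j0" for j
        using uniq[OF that(1)] that(2) sym[of i j] by (auto simp: T_def r_def indicator_def)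
      then have "sum ?f (teams n - {i}) = ?f j0"
        using j0(1) by (intro sum_eq_single) auto
      also have "\<dots> = 1"
        using j0 ki sym[of i j0] by (auto simp: T_def indicator_def matches_def arcs_def r_def)
      finally show ?thesis .
    qed
    show "case e of (i, j) \<Rightarrow> (\<Sum>k\<in>slots n. indicat_real T (k, i, j)) = 1" if "e \<in> arcs n" for e
    proof -
      obtain i j where e: "e = (i, j)" by fastforce
      define k0 where "k0 = circle_colour n i j + (if i < j then 1 else n)"
      have k0: "k0 \<in> slots n" using less[of i j] n by (auto simp: k0_def slots_def)
      have "(k, i, j) \<in> T \<longleftrightarrow> k = k0" if k: "k \<in> slots n" for k
      proof (cases "k \<le> n - 1")
        case True
        then have "(k - 1) mod (n - 1) = k - 1" using k by (intro mod_less) (auto simp: slots_def)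
        then show ?thesis
          using True k \<open>e \<in> arcs n\<close> less[of i j] n by (auto simp: T_def k0_def matches_def e slots_def)
      next
        case False
        \<comment> \<open>The second half starts at slot \<open>n\<close>, which has colour 0
          again.\<close>
        have "(k - 1) mod (n - 1) = (k - n + (n - 1)) mod (n - 1)"
          using False n by (intro arg_cong[of _ _ "\<lambda>l. l mod (n - 1)"]) auto
        also have "\<dots> = (k - n) mod (n - 1)" by (rule mod_add_self2)
        also have "\<dots> = k - n" using k False by (intro mod_less) (auto simp: slots_def)
        finally show ?thesis
          using False k \<open>e \<in> arcs n\<close> less[of i j] n by (auto simp: T_def k0_def matches_def e slots_def)
      qed
      then have "(\<Sum>k\<in>slots n. indicat_real T (k, i, j)) = 1"
        using k0 by (subst sum_eq_single[of _ k0]) auto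
      then show ?thesis by (simp add: e)
    qed
  qed
qed

section \<open>Tournaments with prescribed matches or without a prescribed travel\<close>

text \<open>In any tournament the two matches, having a team in common, lie in different slots
  \<open>p\<close> and \<open>q\<close>. A permutation of the slots then moves them to
  \<open>k1\<close> and \<open>k2\<close>.\<close>

lemma tournament_with_two_matches:
  assumes n: "n \<ge> 2" "even n" and k: "k1 \<in> slots n" "k2 \<in> slots n" "k1 \<noteq> k2"
    and e: "(a, b) \<in> arcs n" "(c, d) \<in> arcs n" "(a, b) \<noteq> (c, d)" "{a, b} \<inter> {c, d} \<noteq> {}"
  shows "\<exists>T. tournament n T \<and> (k1, a, b) \<in> T \<and> (k2, c, d) \<in> T"
proof -
  obtain T where T: "tournament n T" using tournament_exists[OF n] .
  obtain p where p: "p \<in> slots n" "(p, a, b) \<in> T" using tournament_slot_exists[OF T e(1)] .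
  obtain q where q: "q \<in> slots n" "(q, c, d) \<in> T" using tournament_slot_exists[OF T e(2)] .
  have "p \<noteq> q" using tournament_match_unique[OF T p(2), of c d] q(2) e(3,4) by auto
  \<comment> \<open>The inner transposition sends \<open>k1\<close> to \<open>p\<close>. The outer
    one sends the image of \<open>k2\<close> to \<open>q\<close> and leaves \<open>p\<close> alone,
    since \<open>p\<close> differs from both.\<close>
  define \<pi> where "\<pi> = Transposition.transpose (Transposition.transpose k1 p k2) q \<circ> Transposition.transpose k1 p"
  have "Transposition.transpose k1 p permutes slots n" using k p by (intro permutes_swap_id)
  then have "Transposition.transpose k1 p k2 \<in> slots n" using k by (simp add: permutes_in_image)
  then have \<pi>: "\<pi> permutes slots n"
    unfolding \<pi>_def using k p q by (intro permutes_compose permutes_swap_id)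
  have "\<pi> k1 = p" "\<pi> k2 = q"
    using \<open>p \<noteq> q\<close> k(3) by (auto simp: \<pi>_def Transposition.transpose_def)
  then show ?thesis
    using tournament_relabel[OF T \<pi> permutes_id] p q
    by (intro exI[of _ "relabel \<pi> id T"]) (simp add: relabel_def)
qed

text \<open>Team \<open>t\<close> visits each foreign venue in exactly one slot, so two away matches
  of \<open>t\<close> in slots 1 and 2 suffice: at \<open>j\<close> and then \<open>i\<close> if
  both are foreign, at some other \<open>x\<close> just before \<open>j\<close> if
  \<open>i = t\<close>, and at \<open>x\<close> just after \<open>i\<close> if
  \<open>j = t\<close>.\<close>

lemma tournament_without_travel:
  assumes n: "n \<ge> 4" "even n" and t: "t \<in> teams n" and ij: "(i, j) \<in> arcs n"
  obtains T where "tournament n T" "\<not> travels n T t i j"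
proof -
  have sl: "1 \<in> slots n" "2 \<in> slots n" using n by (auto simp: slots_def)
  have i: "i \<in> teams n" and j: "j \<in> teams n" and "i \<noteq> j" using ij by (auto simp: arcs_def)
  have "card {i, j, t} < card (teams n)"
    using n card_insert_le_m1[of 3 "{j, t}" i] card_insert_le_m1[of 2 "{t}" j] by (simp add: teams_def)
  then have "\<not> teams n \<subseteq> {i, j, t}" by (meson card_mono finite.intros leD)
  then obtain x where x: "x \<in> teams n" "x \<notin> {i, j, t}" by blast
  consider "i \<noteq> t" "j \<noteq> t" | "i = t" | "j = t" by blast
  then show thesis
  proof cases
    case 1
    have "\<exists>T. tournament n T \<and> (1, j, t) \<in> T \<and> (2, i, t) \<in> T"
      by (rule tournament_with_two_matches)
        (use n sl i j t x 1 \<open>i \<noteq> j\<close> in \<open>auto simp: arcs_def\<close>)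
    then obtain T where T: "tournament n T" "(1, j, t) \<in> T" "(2, i, t) \<in> T" by blast
    have False if "at_venue n T t p i" "at_venue n T t (Suc p) j" for p
      using that tournament_slot_unique[OF T(1,3), of p] tournament_slot_unique[OF T(1,2), of "Suc p"] 1
      by (auto simp: at_venue_def)
    then have "\<not> travels n T t i j" by (auto simp: travels_def)
    then show thesis using that T(1) by blast
  next
    case 2
    have "\<exists>T. tournament n T \<and> (1, x, t) \<in> T \<and> (2, j, t) \<in> T"
      by (rule tournament_with_two_matches)
        (use n sl i j t x 2 \<open>i \<noteq> j\<close> in \<open>auto simp: arcs_def\<close>)
    then obtain T where T: "tournament n T" "(1, x, t) \<in> T" "(2, j, t) \<in> T" by blast
    have home: "(1, t, l) \<notin> T" "(1, l, t) \<in> T \<Longrightarrow> l = x" for l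
      using tournament_match_unique[OF T(1,2), of t l] tournament_match_unique[OF T(1,2), of l t] x by auto
    \<comment> \<open>The only arrival at \<open>j\<close> is in slot 2, and in slot 1 the team is
      at \<open>x\<close> rather than at home.\<close>
    have "p = 1" if "at_venue n T t (Suc p) j" for p
      using that tournament_slot_unique[OF T(1,3), of "Suc p"] 2 \<open>i \<noteq> j\<close> by (auto simp: at_venue_def)
    moreover have "\<not> at_venue n T t 1 t"
      using home x n by (auto simp: at_venue_def)
    ultimately have "\<not> travels n T t i j" unfolding travels_def using 2 by blast
    then show thesis using that T(1) by blast
  next
    case 3
    have "\<exists>T. tournament n T \<and> (1, i, t) \<in> T \<and> (2, x, t) \<in> T"
      by (rule tournament_with_two_matches)
        (use n sl i j t x 3 \<open>i \<noteq> j\<close> in \<open>auto simp: arcs_def\<close>)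
    then obtain T where T: "tournament n T" "(1, i, t) \<in> T" "(2, x, t) \<in> T" by blast
    have home: "(2, t, l) \<notin> T" "(2, l, t) \<in> T \<Longrightarrow> l = x" for l
      using tournament_match_unique[OF T(1,3), of t l] tournament_match_unique[OF T(1,3), of l t] x by auto
    have "p = 1" if "at_venue n T t p i" for p
      using that tournament_slot_unique[OF T(1,2), of p] 3 \<open>i \<noteq> j\<close> by (auto simp: at_venue_def)
    moreover have "\<not> at_venue n T t 2 t"
      using home x n by (auto simp: at_venue_def)
    ultimately have "\<not> travels n T t i j"
      unfolding travels_def using 3 by (metis Suc_1)
    then show thesis using that T(1) by blast
  qed
qed


definition satisfies_equations :: "nat \<Rightarrow> (nat \<times> nat \<times> nat \<Rightarrow> real) \<Rightarrow> bool"
  where "satisfies_equations n x \<longleftrightarrow>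
    (\<forall>k\<in>slots n. k \<ge> 2 \<longrightarrow> (\<forall>i\<in>teams n.
      (\<Sum>j\<in>teams n - {i}. x (k, i, j) + x (k, j, i)) = 1)) \<and>
    (\<forall>(i, j)\<in>arcs n. (\<Sum>k\<in>slots n. x (k, i, j)) = 1)"

lemma tournament_satisfies_equations:
  "tournament n T \<Longrightarrow> satisfies_equations n (indicat_real T)"
  by (simp add: tournament_def satisfies_equations_def)

section \<open>Linear functionals that are constant on tournaments\<close>

text \<open>The three equations on the triangle 1, 2, 3 determine \<open>u 1\<close>, and then
  \<open>g (1, i)\<close> determines every other \<open>u i\<close>. Four-cycles propagate the
  identity first to the pairs at vertex 2 and then to all remaining pairs.\<close>

lemma four_cycle_condition_imp_vertex_sums:
  fixes g :: "nat \<times> nat \<Rightarrow> real"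
  assumes n: "n \<ge> 3"
    and sym: "\<And>i j. (i, j) \<in> arcs n \<Longrightarrow> g (j, i) = g (i, j)"
    and cycle: "\<And>a b c d. {a, b, c, d} \<subseteq> teams n \<Longrightarrow> distinct [a, b, c, d] \<Longrightarrow>
      g (a, c) + g (b, d) = g (b, c) + g (a, d)"
  shows "\<exists>u. \<forall>(i, j)\<in>arcs n. g (i, j) = u i + u j"
proof -
  \<comment> \<open>This is the solution for \<open>u 1\<close> of
    \<open>g (i, j) = u i + u j\<close> on the triangle 1, 2, 3.\<close>
  define u1 where "u1 = (g (1, 2) + g (1, 3) - g (2, 3)) / 2"
  define u where "u i = (if i = 1 then u1 else g (1, i) - u1)" for i
  have t: "1 \<in> teams n" "2 \<in> teams n" "3 \<in> teams n" using n by (auto simp: teams_def)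
  have s: "g (j, i) = g (i, j)" if "i \<in> teams n" "j \<in> teams n" "i \<noteq> j" for i j
    using sym that by (auto simp: arcs_def)
  have two: "g (2, j) = g (1, 2) + g (1, j) - 2 * u1" if j: "j \<in> teams n" "j \<noteq> 1" "j \<noteq> 2" for j
    using cycle[of 2 1 j 3] j t by (cases "j = 3") (auto simp: u1_def field_simps)
  have gen: "g (i, j) = g (1, i) + g (1, j) - 2 * u1"
    if ij: "i \<in> teams n" "j \<in> teams n" "i \<noteq> j" "i \<noteq> 1" "j \<noteq> 1" for i j
  proof -
    consider "i = 2" | "j = 2" | "i \<noteq> 2" "j \<noteq> 2" by blast
    then show ?thesis
    proof cases
      case 1 then show ?thesis using two[of j] ij by simp
    next
      case 2 then show ?thesis using two[of i] s[of i j] ij by simp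
    next
      case 3
      then have "g (i, j) + g (1, 2) = g (1, j) + g (i, 2)"
        using cycle[of i 1 j 2] ij t by simp
      then show ?thesis using two[of i] s[of 2 i] ij t 3 by simp
    qed
  qed
  have "g (i, j) = u i + u j" if "(i, j) \<in> arcs n" for i j
    using that gen[of i j] s[of 1 j] s[of 1 i] t by (auto simp: u_def arcs_def)
  then show ?thesis by blast
qed

text \<open>This is the situation once the travel coefficients of a separating functional are known
  to vanish: \<open>c\<close> collects its values on the unit vectors of the matches.\<close>

locale constant_on_tournaments =
  fixes n :: nat and c :: "nat \<times> nat \<times> nat \<Rightarrow> real"
  assumes n: "n \<ge> 4" "even n"
    and const: "\<And>T T'. tournament n T \<Longrightarrow> tournament n T' \<Longrightarrow> sum c T = sum c T'"
begin

text \<open>Put the two matches of the pair into the slots \<open>k1\<close> and \<open>k2\<close>.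
  Swapping their venues changes only these two matches, so all other terms cancel from the constant
  sum.\<close>

lemma venue_swap:
  assumes k: "k1 \<in> slots n" "k2 \<in> slots n" and ab: "(a, b) \<in> arcs n"
  shows "c (k1, a, b) - c (k2, a, b) = c (k1, b, a) - c (k2, b, a)"
proof (cases "k1 = k2")
  case False
  have "\<exists>T. tournament n T \<and> (k1, a, b) \<in> T \<and> (k2, b, a) \<in> T"
    by (rule tournament_with_two_matches) (use n k False ab in \<open>auto simp: arcs_def\<close>)
  then obtain T where T: "tournament n T" "(k1, a, b) \<in> T" "(k2, b, a) \<in> T" by blast
  have "a \<noteq> b" using ab by (simp add: arcs_def)
  define R where "R = T - {(k1, a, b), (k2, b, a)}"
  have "finite R" using tournament_finite[OF T(1)] by (simp add: R_def)
  have "(k, a, b) \<in> T \<longleftrightarrow> k = k1" "(k, b, a) \<in> T \<longleftrightarrow> k = k2" for k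
    using tournament_slot_unique[OF T(1)] T(2,3) by blast+
  then have eqs: "T = insert (k1, a, b) (insert (k2, b, a) R)"
    "swap_venues a b T = insert (k1, b, a) (insert (k2, a, b) R)"
    and new: "(k1, a, b) \<notin> R" "(k2, b, a) \<notin> R" "(k1, b, a) \<notin> R" "(k2, a, b) \<notin> R"
    using \<open>a \<noteq> b\<close> False by (auto simp: R_def swap_venues_def doubleton_eq_iff split: if_splits)
  have "sum c T = c (k1, a, b) + c (k2, b, a) + sum c R"
    unfolding eqs(1) using \<open>a \<noteq> b\<close> False \<open>finite R\<close> new by simp
  moreover have "sum c (swap_venues a b T) = c (k1, b, a) + c (k2, a, b) + sum c R"
    unfolding eqs(2) using \<open>a \<noteq> b\<close> False \<open>finite R\<close> new by simp
  ultimately show ?thesis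
    using const[OF T(1) tournament_swap_venues[OF T(1)], of a b] by simp
qed simp

text \<open>Exchanging the two slots preserves the total of \<open>c\<close>. The matches of slot
  \<open>k1\<close> lose the sum of \<open>g\<close>, and those of slot \<open>k2\<close> gain
  it.\<close>

lemma slot_swap:
  assumes k: "k1 \<in> slots n" "k2 \<in> slots n" and T: "tournament n T"
  defines "g \<equiv> \<lambda>e. c (k1, e) - c (k2, e)"
  shows "sum g {e. (k1, e) \<in> T} = sum g {e. (k2, e) \<in> T}"
proof (cases "k1 = k2")
  case False
  define \<pi> where "\<pi> = Transposition.transpose k1 k2"
  have \<pi>: "\<pi> permutes slots n" unfolding \<pi>_def using k by (rule permutes_swap_id)
  have fin: "finite T" using T by (rule tournament_finite)
  have invol: "\<pi> (\<pi> k) = k" for k by (simp add: \<pi>_def)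
  have "sum c (relabel \<pi> id T) = (\<Sum>(k, e)\<in>T. c (\<pi> k, e))"
    by (rule sum.reindex_bij_witness[of _ "\<lambda>(k, e). (\<pi> k, e)" "\<lambda>(k, e). (\<pi> k, e)"])
      (auto simp: relabel_def invol)
  then have "0 = sum c T - (\<Sum>(k, e)\<in>T. c (\<pi> k, e))"
    using const[OF T tournament_relabel[OF T \<pi> permutes_id]] by simp
  also have "\<dots> = (\<Sum>(k, e)\<in>T. c (k, e) - c (\<pi> k, e))"
    by (simp add: sum_subtractf case_prod_unfold)
  \<comment> \<open>Matches in all other slots are fixed by \<open>\<pi>\<close> and contribute
    0.\<close>
  also have "\<dots> = (\<Sum>(k, e)\<in>{k1} \<times> {e. (k1, e) \<in> T} \<union> {k2} \<times> {e. (k2, e) \<in> T}. c (k, e) - c (\<pi> k, e))"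
    using fin by (intro sum.mono_neutral_right) (auto simp: \<pi>_def Transposition.transpose_def split: if_splits)
  also have "\<dots> = (\<Sum>(k, e)\<in>{k1} \<times> {e. (k1, e) \<in> T}. c (k, e) - c (\<pi> k, e)) +
      (\<Sum>(k, e)\<in>{k2} \<times> {e. (k2, e) \<in> T}. c (k, e) - c (\<pi> k, e))"
  proof (rule sum.union_disjoint)
    show "finite ({k1} \<times> {e. (k1, e) \<in> T})" "finite ({k2} \<times> {e. (k2, e) \<in> T})"
      by (auto intro: finite_subset[OF _ fin])
  qed (use False in auto)
  also have "\<dots> = sum g {e. (k1, e) \<in> T} - sum g {e. (k2, e) \<in> T}"
    by (simp add: sum.cartesian_product[symmetric] \<pi>_def g_def sum_negf[symmetric])
  finally show ?thesis by simp
qed simp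

text \<open>
  Antisymmetrising a slot swap over the team transpositions \<open>(a b)\<close> and \<open>(p q)\<close> kills every pair
  of teams except the sides of the four-cycle \<open>a p b q\<close>. In a tournament with the match \<open>(a, p)\<close>
  in slot \<open>k1\<close> and \<open>(a, q)\<close> in slot \<open>k2\<close> the two slots contribute sides of opposite sign, so that
  nothing cancels.
\<close>

lemma four_cycle:
  assumes k: "k1 \<in> slots n" "k2 \<in> slots n" "k1 \<noteq> k2"
    and t: "{a, b, p, q} \<subseteq> teams n" and dist: "distinct [a, b, p, q]"
  defines "g \<equiv> \<lambda>e. c (k1, e) - c (k2, e)"
  shows "g (a, p) + g (b, q) = g (b, p) + g (a, q)"
proof -
  have "\<exists>T. tournament n T \<and> (k1, a, p) \<in> T \<and> (k2, a, q) \<in> T"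
    by (rule tournament_with_two_matches) (use n k t dist in \<open>auto simp: arcs_def\<close>)
  then obtain T where T: "tournament n T" "(k1, a, p) \<in> T" "(k2, a, q) \<in> T" by blast
  define E where "E k = {e. (k, e) \<in> T}" for k
  have finE: "finite (E k)" for k
    using finite_imageI[OF tournament_finite[OF T(1)], of snd]
    by (rule finite_subset[rotated]) (force simp: E_def)
  \<comment> \<open>The slot swap is applied to \<open>T\<close> with its teams renamed by
    \<open>\<sigma>\<close>; the inverse appears because \<open>relabel\<close> pulls back.\<close>
  have perm: "(\<Sum>(i, j)\<in>E k1. g (\<sigma> i, \<sigma> j)) = (\<Sum>(i, j)\<in>E k2. g (\<sigma> i, \<sigma> j))"
    if \<sigma>: "\<sigma> permutes teams n" for \<sigma>
  proof -
    let ?T = "relabel id (inv \<sigma>) T"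
    have "sum g {e. (k, e) \<in> ?T} = (\<Sum>(i, j)\<in>E k. g (\<sigma> i, \<sigma> j))" for k
      by (rule sum.reindex_bij_witness[of _ "\<lambda>(i, j). (\<sigma> i, \<sigma> j)" "\<lambda>(i, j). (inv \<sigma> i, inv \<sigma> j)"])
        (auto simp: relabel_def E_def permutes_inverses[OF \<sigma>])
    then show ?thesis
      using slot_swap[OF k(1,2) tournament_relabel[OF T(1) permutes_id permutes_inv[OF \<sigma>]]]
      by (simp add: g_def)
  qed
  define \<tau>1 where "\<tau>1 = Transposition.transpose a b"
  define \<tau>2 where "\<tau>2 = Transposition.transpose p q"
  have \<tau>1: "\<tau>1 permutes teams n" and \<tau>2: "\<tau>2 permutes teams n"
    unfolding \<tau>1_def \<tau>2_def using t by (auto intro!: permutes_swap_id)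
  define h where "h = (\<lambda>(i, j). g (i, j) - g (\<tau>1 i, \<tau>1 j) - g (\<tau>2 i, \<tau>2 j) + g (\<tau>1 (\<tau>2 i), \<tau>1 (\<tau>2 j)))"
  have h_sum: "sum h (E k) = (\<Sum>(i, j)\<in>E k. g (id i, id j)) - (\<Sum>(i, j)\<in>E k. g (\<tau>1 i, \<tau>1 j))
      - (\<Sum>(i, j)\<in>E k. g (\<tau>2 i, \<tau>2 j)) + (\<Sum>(i, j)\<in>E k. g ((\<tau>1 \<circ> \<tau>2) i, (\<tau>1 \<circ> \<tau>2) j))" for k
    by (simp add: h_def case_prod_unfold sum.distrib sum_subtractf)
  have h_eq: "sum h (E k1) = sum h (E k2)"
    unfolding h_sum using perm[OF permutes_id] perm[OF \<tau>1] perm[OF \<tau>2] perm[OF permutes_compose[OF \<tau>2 \<tau>1]]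
    by simp
  define Q where "Q = g (a, p) - g (b, p) - g (a, q) + g (b, q)"
  define pos where "pos = {(a, p), (p, a), (b, q), (q, b)}"
  define neg where "neg = {(a, q), (q, a), (b, p), (p, b)}"
  have g_sym: "g (j, i) = g (i, j)" if "i \<in> teams n" "j \<in> teams n" "i \<noteq> j" for i j
    using venue_swap[OF k(1,2), of i j] that by (simp add: g_def arcs_def)
  have sides: "g (p, a) = g (a, p)" "g (q, a) = g (a, q)" "g (p, b) = g (b, p)" "g (q, b) = g (b, q)"
    "g (b, a) = g (a, b)" "g (q, p) = g (p, q)"
    using g_sym t dist by auto
  have tau: "\<tau>1 a = b" "\<tau>1 b = a" "\<tau>1 p = p" "\<tau>1 q = q" "\<tau>2 a = a" "\<tau>2 b = b" "\<tau>2 p = q" "\<tau>2 q = p"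
    using dist by (auto simp: \<tau>1_def \<tau>2_def)
  have other: "\<tau>1 i = i" "\<tau>2 i = i" if "i \<notin> {a, b, p, q}" for i
    using that by (auto simp: \<tau>1_def \<tau>2_def Transposition.transpose_def)
  \<comment> \<open>A pair that is not a side of the four-cycle misses \<open>{a, b}\<close> or
    \<open>{p, q}\<close>. It is then fixed by \<open>\<tau>1\<close> or \<open>\<tau>2\<close>, and
    its four terms cancel in twos.\<close>
  have h: "h e = Q * (indicat_real pos e - indicat_real neg e)" if "e \<in> E k" for e k
  proof -
    obtain i j where e: "e = (i, j)" by fastforce
    have ij: "i \<in> teams n" "j \<in> teams n" "i \<noteq> j"
      using tournament_arc[OF T(1)] that by (auto simp: E_def e)
    have "i = a \<or> i = b \<or> i = p \<or> i = q \<or> i \<notin> {a, b, p, q}"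
      "j = a \<or> j = b \<or> j = p \<or> j = q \<or> j \<notin> {a, b, p, q}" by auto
    then show ?thesis
      using ij dist
      by (elim disjE)
        (simp_all add: e h_def Q_def pos_def neg_def indicator_def tau other sides)
  qed
  \<comment> \<open>Every pair in \<open>neg\<close> shares a team with the match
    \<open>(a, p)\<close> of slot \<open>k1\<close>. Likewise every pair in \<open>pos\<close>
    shares one with \<open>(a, q)\<close> in slot \<open>k2\<close>.\<close>
  have sign1: "e \<notin> neg" if "e \<in> E k1" for e
    using that tournament_match_unique[OF T(1,2), of "fst e" "snd e"] dist by (auto simp: E_def neg_def)
  have sign2: "e \<notin> pos" if "e \<in> E k2" for e
    using that tournament_match_unique[OF T(1,3), of "fst e" "snd e"] dist by (auto simp: E_def pos_def)
  have "1 = sum (indicat_real pos) {(a, p)}" by (simp add: pos_def)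
  also have "\<dots> \<le> sum (indicat_real pos) (E k1)"
    using finE T(2) by (intro sum_mono2) (auto simp: E_def)
  finally have S: "1 \<le> sum (indicat_real pos) (E k1)" .
  have "sum h (E k1) = Q * sum (indicat_real pos) (E k1)"
    unfolding sum_distrib_left using h sign1 by (intro sum.cong) auto
  moreover have "sum h (E k2) = - Q * sum (indicat_real neg) (E k2)"
    unfolding sum_distrib_left using h sign2 by (intro sum.cong) auto
  \<comment> \<open>The opposite signs turn the equality of the two sums into \<open>Q\<close> times
    a sum of nonnegative counts, the first of which is at least 1.\<close>
  ultimately have "Q * (sum (indicat_real pos) (E k1) + sum (indicat_real neg) (E k2)) = 0"
    using h_eq by (simp add: algebra_simps)
  moreover have "sum (indicat_real neg) (E k2) \<ge> 0" by (intro sum_nonneg) auto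
  ultimately have "Q = 0" using S by auto
  then show ?thesis by (simp add: Q_def)
qed

text \<open>Since \<open>c (k, i, j) = c (1, i, j) + u k i + u k j\<close>, the functional is the
  combination of the equations with coefficient \<open>c (1, i, j)\<close> at the match equation of
  \<open>(i, j)\<close> and \<open>u k i\<close> at the slot equation of \<open>k\<close> and
  \<open>i\<close>.\<close>

lemma constant_on_equations:
  obtains \<beta> where "\<And>x. satisfies_equations n x \<Longrightarrow> (\<Sum>m\<in>matches n. c m * x m) = \<beta>"
proof -
  have one: "1 \<in> slots n" using n by (simp add: slots_def)
  \<comment> \<open>Slot 1 is the reference. Its \<open>u\<close> is fixed to 0 because
    \<open>satisfies_equations\<close> contains no slot equation for slot 1.\<close>
  have ex: "\<forall>k\<in>slots n. \<exists>u. (k = 1 \<longrightarrow> u = (\<lambda>_. 0)) \<and>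
      (\<forall>(i, j)\<in>arcs n. c (k, i, j) - c (1, i, j) = u i + u j)"
  proof (rule ballI, goal_cases)
    case k: (1 k)
    show ?case
    proof (cases "k = 1")
      case False
      have "\<exists>u. \<forall>(i, j)\<in>arcs n. c (k, i, j) - c (1, i, j) = u i + u j"
      proof (rule four_cycle_condition_imp_vertex_sums)
        show "n \<ge> 3" using n by simp
        show "c (k, j, i) - c (1, j, i) = c (k, i, j) - c (1, i, j)" if "(i, j) \<in> arcs n" for i j
          using venue_swap[OF k one that] by simp
        show "c (k, a, p) - c (1, a, p) + (c (k, b, q) - c (1, b, q)) =
            c (k, b, p) - c (1, b, p) + (c (k, a, q) - c (1, a, q))"
          if "{a, b, p, q} \<subseteq> teams n" "distinct [a, b, p, q]" for a b p q
          using four_cycle[OF k one False that] .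
      qed
      then show ?thesis using False by auto
    qed (auto intro!: exI[of _ "\<lambda>_. 0"])
  qed
  obtain u where "\<forall>k\<in>slots n. (k = 1 \<longrightarrow> u k = (\<lambda>_. 0)) \<and>
      (\<forall>(i, j)\<in>arcs n. c (k, i, j) - c (1, i, j) = u k i + u k j)"
    using bchoice[OF ex] by blast
  then have u1: "u 1 = (\<lambda>_. 0)"
    and u: "\<And>k i j. k \<in> slots n \<Longrightarrow> (i, j) \<in> arcs n \<Longrightarrow> c (k, i, j) = c (1, i, j) + (u k i + u k j)"
    using one by (auto simp: algebra_simps)
  show thesis
  proof
    fix x :: "nat \<times> nat \<times> nat \<Rightarrow> real"
    assume "satisfies_equations n x"
    then have slot: "\<forall>k\<in>slots n. k \<ge> 2 \<longrightarrow> (\<forall>i\<in>teams n.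
        (\<Sum>j\<in>teams n - {i}. x (k, i, j) + x (k, j, i)) = 1)"
      and match: "\<forall>(i, j)\<in>arcs n. (\<Sum>k\<in>slots n. x (k, i, j)) = 1"
      by (simp_all add: satisfies_equations_def)
    \<comment> \<open>Reversing arcs moves the weight of the away team to the first index, so that
      both weights of a match collect into the slot equation of a single team.\<close>
    have swap: "(\<Sum>(i, j)\<in>arcs n. u k j * x (k, i, j)) = (\<Sum>(i, j)\<in>arcs n. u k i * x (k, j, i))" for k
      by (rule sum.reindex_bij_witness[of _ prod.swap prod.swap]) (auto simp: arcs_def)
    have per_slot: "(\<Sum>(i, j)\<in>arcs n. (u k i + u k j) * x (k, i, j)) = (\<Sum>i\<in>teams n. u k i)"
      if k: "k \<in> slots n" for k
    proof (cases "k = 1")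
      case False
      then have "k \<ge> 2" using k by (auto simp: slots_def)
      have "(\<Sum>(i, j)\<in>arcs n. (u k i + u k j) * x (k, i, j)) =
          (\<Sum>(i, j)\<in>arcs n. u k i * x (k, i, j)) + (\<Sum>(i, j)\<in>arcs n. u k j * x (k, i, j))"
        by (simp add: case_prod_unfold sum.distrib distrib_right)
      also have "\<dots> = (\<Sum>(i, j)\<in>arcs n. u k i * (x (k, i, j) + x (k, j, i)))"
        unfolding swap by (simp add: case_prod_unfold sum.distrib distrib_left)
      also have "\<dots> = (\<Sum>i\<in>teams n. u k i * (\<Sum>j\<in>teams n - {i}. x (k, i, j) + x (k, j, i)))"
        unfolding arcs_Sigma by (subst sum.Sigma[symmetric]) (auto simp: sum_distrib_left)
      also have "\<dots> = (\<Sum>i\<in>teams n. u k i)"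
        using slot k \<open>k \<ge> 2\<close> by (intro sum.cong) auto
      finally show ?thesis .
    qed (use u1 in \<open>simp add: case_prod_unfold\<close>)
    have "(\<Sum>m\<in>matches n. c m * x m) = (\<Sum>k\<in>slots n. \<Sum>e\<in>arcs n. c (k, e) * x (k, e))"
      by (simp add: matches_def sum.cartesian_product case_prod_unfold)
    also have "\<dots> = (\<Sum>k\<in>slots n. \<Sum>e\<in>arcs n.
        c (1, e) * x (k, e) + (case e of (i, j) \<Rightarrow> (u k i + u k j) * x (k, i, j)))"
      by (intro sum.cong refl) (auto simp: u distrib_right split: prod.splits)
    also have "\<dots> = (\<Sum>k\<in>slots n. \<Sum>e\<in>arcs n. c (1, e) * x (k, e)) + (\<Sum>k\<in>slots n. \<Sum>i\<in>teams n. u k i)"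
      by (simp add: sum.distrib per_slot)
    also have "(\<Sum>k\<in>slots n. \<Sum>e\<in>arcs n. c (1, e) * x (k, e)) = (\<Sum>e\<in>arcs n. c (1, e) * (\<Sum>k\<in>slots n. x (k, e)))"
      by (subst sum.swap) (simp add: sum_distrib_left)
    also have "\<dots> = (\<Sum>e\<in>arcs n. c (1, e))"
      using match by (intro sum.cong) auto
    finally show "(\<Sum>m\<in>matches n. c m * x m) = (\<Sum>e\<in>arcs n. c (1, e)) + (\<Sum>k\<in>slots n. \<Sum>i\<in>teams n. u k i)" .
  qed
qed

end

section \<open>The affine hull and the irredundancy of the equations\<close>

lemma affine_equations:
  "affine {(x, y) \<in> utt_space n. satisfies_equations n x}"
  unfolding affine_def
proof (intro ballI allI impI)
  fix s s' and u v :: real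
  assume s: "s \<in> {(x, y) \<in> utt_space n. satisfies_equations n x}"
    "s' \<in> {(x, y) \<in> utt_space n. satisfies_equations n x}" and uv: "u + v = 1"
  then obtain x y x' y' where [simp]: "s = (x, y)" "s' = (x', y')"
    and eq: "satisfies_equations n x" "satisfies_equations n x'"
    by blast
  have "satisfies_equations n (u *\<^sub>R x + v *\<^sub>R x') \<and>
    (u *\<^sub>R x + v *\<^sub>R x', u *\<^sub>R y + v *\<^sub>R y') \<in> utt_space n"
  proof
    show "(u *\<^sub>R x + v *\<^sub>R x', u *\<^sub>R y + v *\<^sub>R y') \<in> utt_space n"
      using s by (auto simp: utt_space_def coord_space_def scaleR_fun_def)
    \<comment> \<open>All right-hand sides equal 1, so \<open>u + v = 1\<close> preserves
      them.\<close>
    have comb: "(\<Sum>a\<in>A. u * f a + v * g a) = 1" if "sum f A = 1" "sum g A = 1"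
      for f g :: "nat \<Rightarrow> real" and A
      using that uv by (simp add: sum.distrib flip: sum_distrib_left)
    show "satisfies_equations n (u *\<^sub>R x + v *\<^sub>R x')"
      unfolding satisfies_equations_def
    proof (intro conjI ballI impI)
      fix k i assume k: "k \<in> slots n" "2 \<le> k" "i \<in> teams n"
      have "(\<Sum>j\<in>teams n - {i}. u * (x (k, i, j) + x (k, j, i)) + v * (x' (k, i, j) + x' (k, j, i))) = 1"
        by (rule comb) (use eq k in \<open>auto simp: satisfies_equations_def\<close>)
      then show "(\<Sum>j\<in>teams n - {i}. (u *\<^sub>R x + v *\<^sub>R x') (k, i, j) + (u *\<^sub>R x + v *\<^sub>R x') (k, j, i)) = 1"
        by (simp add: scaleR_fun_def algebra_simps)
    next
      fix e assume e: "e \<in> arcs n"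
      have "(\<Sum>k\<in>slots n. u * x (k, e) + v * x' (k, e)) = 1"
        by (rule comb) (use eq e in \<open>auto simp: satisfies_equations_def\<close>)
      then show "case e of (i, j) \<Rightarrow> (\<Sum>k\<in>slots n. (u *\<^sub>R x + v *\<^sub>R x') (k, i, j)) = 1"
        by (simp add: scaleR_fun_def split: prod.splits)
    qed
  qed
  then show "u *\<^sub>R s + v *\<^sub>R s' \<in> {(x, y) \<in> utt_space n. satisfies_equations n x}" by simp
qed

lemma affine_hull_P_utt:
  assumes n: "n \<ge> 4" "even n"
  shows "affine hull (P_utt n) = {(x, y) \<in> utt_space n. satisfies_equations n x}"
proof -
  define G where "G = {(indicat_real T, y) | T y.
      tournament n T \<and>
      y \<in> coord_space (teams n \<times> arcs n) \<and>
      (\<forall>a\<in>teams n \<times> arcs n. y a \<in> {0, 1} \<and> travel_vector n T a \<le> y a)}"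
  have ind_coord: "indicat_real T \<in> coord_space (matches n)" if "tournament n T" for T
    using that by (auto simp: tournament_def coord_space_def indicator_def)
  have tv: "(indicat_real T, travel_vector n T) \<in> G" if "tournament n T" for T
    using that by (auto simp: G_def travel_vector_def coord_space_def indicator_def)
  have "affine hull G = {(x, y) \<in> utt_space n. satisfies_equations n x}"
  proof (intro equalityI hull_minimal affine_equations subsetI)
    fix s assume "s \<in> G"
    then show "s \<in> {(x, y) \<in> utt_space n. satisfies_equations n x}"
      using ind_coord tournament_satisfies_equations by (auto simp: G_def utt_space_def)
  next
    fix s assume "s \<in> {(x, y) \<in> utt_space n. satisfies_equations n x}"
    then obtain x y where s: "s = (x, y)" and xy: "(x, y) \<in> utt_space n" and x: "satisfies_equations n x"
      by auto
    obtain T0 where T0: "tournament n T0" using tournament_exists[of n] n by auto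
    show "s \<in> affine hull G"
    proof (rule ccontr)
      assume "s \<notin> affine hull G"
      then obtain f :: "_ \<Rightarrow> real" where f: "linear f"
        and fG: "\<And>s. s \<in> G \<Longrightarrow> f s = f (indicat_real T0, travel_vector n T0)"
        and fs: "f s \<noteq> f (indicat_real T0, travel_vector n T0)"
        using affine_hull_separation[OF tv[OF T0]] by metis
      define c where "c m = f (indicat_real {m}, 0)" for m
      define d where "d a = f (0, indicat_real {a})" for a
      have f_split: "f (x, y) = f (x, 0) + f (0, y)" for x y
        using linear_add[OF f, of "(x, 0)" "(0, y)"] by simp
      have "linear (\<lambda>x. f (x, 0))" "linear (\<lambda>y. f (0, y))"
        using linear_compose[OF _ f, of "\<lambda>x. (x, 0)"] linear_compose[OF _ f, of "\<lambda>y. (0, y)"]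
        by (simp_all add: o_def linear_iff)
      then have f_eq: "f (x, y) = (\<Sum>m\<in>matches n. c m * x m) + (\<Sum>a\<in>teams n \<times> arcs n. d a * y a)"
        if "(x, y) \<in> utt_space n" for x y
        using that linear_on_coord_space[of "\<lambda>x. f (x, 0)" "matches n" x]
          linear_on_coord_space[of "\<lambda>y. f (0, y)" "teams n \<times> arcs n" y] f_split[of x y]
        by (simp add: utt_space_def c_def d_def)
      \<comment> \<open>For a tournament that avoids the travel \<open>a\<close>, raising that
        coordinate from 0 to 1 stays within the generators and changes \<open>f\<close> by
        \<open>d a\<close>.\<close>
      have d0: "d a = 0" if a: "a \<in> teams n \<times> arcs n" for a
      proof -
        obtain t i j where tij: "a = (t, i, j)" by (cases a)
        obtain T where T: "tournament n T" "\<not> travels n T t i j"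
          using tournament_without_travel[OF n, of t i j] a tij by auto
        have "(indicat_real T, travel_vector n T + indicat_real {a}) \<in> G"
          using T a by (auto simp: G_def travel_vector_def coord_space_def indicator_def tij)
        then have "f (indicat_real T, travel_vector n T + indicat_real {a}) = f (indicat_real T, travel_vector n T)"
          using fG tv[OF T(1)] by metis
        then show ?thesis
          using linear_add[OF f, of "(indicat_real T, travel_vector n T)" "(0, indicat_real {a})"]
          by (simp add: d_def)
      qed
      have f_eq': "f (x, y) = (\<Sum>m\<in>matches n. c m * x m)" if "(x, y) \<in> utt_space n" for x y
        using f_eq[OF that] d0 by simp
      have tv_space: "(indicat_real T, travel_vector n T) \<in> utt_space n" if "tournament n T" for T
        using tv[OF that] ind_coord[OF that] by (auto simp: G_def utt_space_def)
      have c_sum: "(\<Sum>m\<in>matches n. c m * indicat_real T m) = sum c T" if "tournament n T" for T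
        using that by (intro sum.mono_neutral_cong_right) (auto simp: tournament_def indicator_def)
      interpret constant_on_tournaments n c
      proof
        fix T T' assume "tournament n T" "tournament n T'"
        then show "sum c T = sum c T'"
          using fG[OF tv] f_eq'[OF tv_space] c_sum by metis
      qed (use n in auto)
      obtain \<beta> where \<beta>: "\<And>x. satisfies_equations n x \<Longrightarrow> (\<Sum>m\<in>matches n. c m * x m) = \<beta>"
        using constant_on_equations by blast
      \<comment> \<open>Both \<open>x\<close> and the incidence vector of \<open>T0\<close> solve
        the equations, so \<open>f\<close> takes the value \<beta> at both points and does not
        separate them.\<close>
      show False
        using fs f_eq'[OF xy] f_eq'[OF tv_space[OF T0]] \<beta>[OF x] \<beta>[OF tournament_satisfies_equations[OF T0]]
        by (simp add: s)
    qed
  qed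
  \<comment> \<open>A convex hull has the same affine hull as its generators.\<close>
  then show ?thesis by (simp add: P_utt_def G_def)
qed

section \<open>Irredundancy of the equations\<close>

text \<open>Evaluating a supposed combination at the witness \<open>v\<close> gives a nonzero left
  side and a zero right side. This already contradicts the left-hand sides, whatever
  \<open>b\<close> is.\<close>

lemma irredundantI:
  assumes "\<And>e. e \<in> E \<Longrightarrow> \<exists>v\<in>X. L e v \<noteq> 0 \<and> (\<forall>e'\<in>E - {e}. L e' v = 0)"
  shows "irredundant E X L b"
  unfolding irredundant_def
proof (intro ballI notI)
  fix e assume "e \<in> E" and "\<exists>c. (\<forall>v\<in>X. L e v = (\<Sum>e'\<in>E - {e}. c e' * L e' v)) \<and>
    b e = (\<Sum>e'\<in>E - {e}. c e' * b e')"
  then show False using assms[OF \<open>e \<in> E\<close>] by fastforce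
qed

lemma degree_single_arc:
  assumes "(a, b) \<in> arcs n" "t \<in> teams n"
  shows "(\<Sum>s\<in>teams n - {t}. indicat_real {(a, b)} (t, s) + indicat_real {(a, b)} (s, t)) =
    of_bool (t = a) + of_bool (t = b)"
proof -
  have ab: "a \<in> teams n" "b \<in> teams n" "a \<noteq> b" using assms by (auto simp: arcs_def)
  consider "t = a" | "t = b" | "t \<noteq> a" "t \<noteq> b" by blast
  then show ?thesis
  proof cases
    case 1 then show ?thesis using ab by (subst sum_eq_single[of _ b]) auto
  next
    case 2 then show ?thesis using ab by (subst sum_eq_single[of _ a]) auto
  next
    case 3 then show ?thesis by (intro trans[OF sum.neutral]) auto
  qed
qed

lemma equations_irredundant:
  assumes n: "n \<ge> 4"
  shows "irredundant (equations n) (utt_space n) (lhs n) b"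
proof (rule irredundantI)
  have one: "1 \<in> slots n" using n by (simp add: slots_def)
  fix e assume "e \<in> equations n"
  then consider (slot) k i where "e = Slot_Eq k i" "k \<in> slots n" "k \<ge> 2" "i \<in> teams n"
    | (match) a b where "e = Match_Eq a b" "(a, b) \<in> arcs n"
    by (auto simp: equations_def)
  then show "\<exists>v\<in>utt_space n. lhs n e v \<noteq> 0 \<and> (\<forall>e'\<in>equations n - {e}. lhs n e' v = 0)"
  proof cases
    case slot
    have "card {i} < card (teams n)" using n by (simp add: teams_def)
    then have "\<not> teams n \<subseteq> {i}" by (meson card_mono finite.intros leD)
    then obtain j where j: "j \<in> teams n" "j \<noteq> i" by blast
    have "card {i, j} < card (teams n)" using n j by (simp add: teams_def)
    then have "\<not> teams n \<subseteq> {i, j}" by (meson card_mono finite.intros leD)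
    then obtain h where h: "h \<in> teams n" "h \<noteq> i" "h \<noteq> j" by blast
    have ar: "(i, j) \<in> arcs n" "(i, h) \<in> arcs n" "(j, h) \<in> arcs n"
      using slot j h by (auto simp: arcs_def)
    text \<open>This weighting of the triangle \<open>i j h\<close> has degree \<open>2\<close> at \<open>i\<close> and \<open>0\<close> elsewhere.\<close>
    define w where "w e = indicat_real {(i, j)} e + indicat_real {(i, h)} e - indicat_real {(j, h)} e" for e
    \<comment> \<open>The copy of \<open>w\<close> with opposite sign in slot 1 cancels
      \<open>w\<close> in every match equation, while no slot equation of the system sees slot
      1.\<close>
    define x where "x = (\<lambda>(l, e). of_bool (l = k) * w e - of_bool (l = 1) * w e)"
    have deg: "(\<Sum>s\<in>teams n - {t}. w (t, s) + w (s, t)) = 2 * of_bool (t = i)" if "t \<in> teams n" for t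
    proof -
      have "(\<Sum>s\<in>teams n - {t}. w (t, s) + w (s, t)) =
          (\<Sum>s\<in>teams n - {t}. indicat_real {(i, j)} (t, s) + indicat_real {(i, j)} (s, t)) +
          (\<Sum>s\<in>teams n - {t}. indicat_real {(i, h)} (t, s) + indicat_real {(i, h)} (s, t)) -
          (\<Sum>s\<in>teams n - {t}. indicat_real {(j, h)} (t, s) + indicat_real {(j, h)} (s, t))"
        unfolding w_def by (simp only: sum.distrib sum_subtractf)
      then show ?thesis
        unfolding degree_single_arc[OF ar(1) that] degree_single_arc[OF ar(2) that]
          degree_single_arc[OF ar(3) that] by simp
    qed
    have slot_lhs: "lhs n (Slot_Eq l t) (x, 0) = of_bool (l = k) * (2 * of_bool (t = i))"
      if "l \<ge> 2" "t \<in> teams n" for l t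
      using that deg by (simp add: x_def)
    have match_lhs: "lhs n (Match_Eq a b) (x, 0) = 0" for a b
    proof -
      have "(\<Sum>l\<in>slots n. of_bool (l = k0) * w (a, b)) = w (a, b)" if "k0 \<in> slots n" for k0
        using that by (subst sum_eq_single[of _ k0]) auto
      then show ?thesis using one slot by (simp add: x_def sum_subtractf)
    qed
    have "(x, 0) \<in> utt_space n"
      using ar one slot by (auto simp: utt_space_def coord_space_def x_def w_def matches_def indicator_def)
    moreover have "lhs n e' (x, 0) = 0" if "e' \<in> equations n - {e}" for e'
      using that slot_lhs match_lhs slot(1) by (auto simp: equations_def simp del: lhs.simps)
    moreover have "lhs n e (x, 0) \<noteq> 0"
      using slot_lhs[of k i] slot by (simp del: lhs.simps)
    ultimately show ?thesis by blast
  next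
    case match
    \<comment> \<open>A single match in slot 1 is invisible to all slot equations with
      \<open>k \<ge> 2\<close> and occurs in one match equation only.\<close>
    define x where "x = indicat_real {(1::nat, a, b)}"
    have "(x, 0) \<in> utt_space n"
      using match one by (auto simp: utt_space_def coord_space_def x_def matches_def indicator_def)
    moreover have "lhs n (Match_Eq i j) (x, 0) = of_bool ((i, j) = (a, b))" for i j
      using one by (simp add: x_def, subst sum_eq_single[of _ 1]) (auto simp: indicator_def)
    moreover have "lhs n (Slot_Eq k i) (x, 0) = 0" if "k \<ge> 2" for k i
      using that by (simp add: x_def indicator_def)
    ultimately show ?thesis
      using match(1) by (intro bexI[of _ "(x, 0)"]) (auto simp: equations_def simp del: lhs.simps)
  qed
qed

theorem theorem5:
  fixes n :: nat
  assumes "n \<ge> 4" and "even n"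
  shows "affine hull (P_utt n) =
      {(x, y) \<in> utt_space n.
        (\<forall>k\<in>slots n. k \<ge> 2 \<longrightarrow> (\<forall>i\<in>teams n.
          (\<Sum>j\<in>teams n - {i}. x (k, i, j) + x (k, j, i)) = 1)) \<and>
        (\<forall>(i, j)\<in>arcs n. (\<Sum>k\<in>slots n. x (k, i, j)) = 1)}
    \<and> irredundant (equations n) (utt_space n) (lhs n) (\<lambda>e. 1)"
  using affine_hull_P_utt[OF assms] equations_irredundant[OF assms(1)]
  by (simp add: satisfies_equations_def)

end
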